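(* Let $X,Y\subset\mathbb{R}^n$ be closed convex sets with $X\cap Y\ne\emptyset$. Let $(z^k)_{k\in\mathbb{N}}$ be the sequence generated by the centralized circumcentered-reflection method (cCRM) starting from some $z^0\in\mathbb{R}^n$, i.e. $z^{k+1}=T(z^k)$. Assume also that $(z^k)_{k\in\mathbb{N}}$ is an infinite sequence. If the error bound condition (EB) holds around the limit $\bar z$ of $(z^k)_{k\in\mathbb{N}}$ with $\omega \in (0,1)$ and neighborhood $V$, then the sequence $(z^k)_{k\in\mathbb{N}}$ converges R-linearly to some point in $X\cap Y$, with asymptotic constant bounded above by $\beta^2\left(\frac{1+\beta}{2}\right)$, where $\beta=\sqrt{1-\omega^2}$ and $\omega$ is the constant in (EB).
   Context: $P_X,P_Y$ denote the orthogonal projections onto $X,Y$ in $\mathbb{R}^n$ with the Euclidean norm $\|\cdot\|$, $\operatorname{dist}$ is the Euclidean distance to a set, and $R_X:=2P_X-\mathrm{Id}$, $R_Y:=2P_Y-\mathrm{Id}$ are the reflections. For $z,v,w\in\mathbb{R}^n$, the circumcenter $\operatorname{circ}(z,v,w)$ is the point $p$ satisfying (i) $\|p-z\|=\|p-v\|=\|p-w\|$ and (ii) $p\in\operatorname{aff}\{z,v,w\}:=\{z+\alpha(v-z)+\beta'(w-z)\mid \alpha,\beta'\in\mathbb{R}\}$. It is well and uniquely defined if $\{z,v,w\}$ has cardinality one or two; when the three points are all distinct, it is well and uniquely defined only if they are not collinear. The cCRM operator $T:\mathbb{R}^n\to\mathbb{R}^n$ is $T(z):=\operatorname{circ}(z_C,R_X(z_C),R_Y(z_C))$,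 where $z_C:=\frac12(z_{\mathrm{MAP}}+P_X(z_{\mathrm{MAP}}))$ and $z_{\mathrm{MAP}}:=P_YP_X(z)$. The sequence $z^{k+1}=T(z^k)$ is known to converge to a point of $X\cap Y$ for every $z^0\in\mathbb{R}^n$, and the fixed points of $T$ are exactly the points of $X\cap Y$. "Infinite sequence" means that no iterate $z^k$ lies in $X\cap Y$. (EB) holds around $\bar z\in X\cap Y$ with $\omega\in(0,1)$ and neighborhood $V$ of $\bar z$ when $\omega\operatorname{dist}(z,X\cap Y)\le\max\{\operatorname{dist}(z,X),\operatorname{dist}(z,Y)\}$ for all $z\in V$. For a sequence $(w^k)_{k\in\mathbb{N}}\subset\mathbb{R}^n$ converging to $\bar w$ with $w^k\neq\bar w$ for all $k$, put $r:=\limsup_{k\to\infty}\|w^k-\bar w\|^{1/k}$. The convergence is R-linear if $r\in(0,1)$, and $r$ is the corresponding asymptotic constant.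
   Formalization: With R-linear meaning r in (0,1), the claim fails for X={y>=x^2-1}, Y={y<=0}, z^0=(2,0), where convergence is quadratic and r=0; the formal conclusion therefore allows r=0 (faster than R-linear) besides R-linear, with the same upper bound on r. *)

theory Defs
  imports "HOL-Analysis.Analysis"
begin

definition reflection :: "'a::euclidean_space set \<Rightarrow> 'a \<Rightarrow> 'a" where
  "reflection S z = 2 *\<^sub>R closest_point S z - z"

definition is_circumcenter :: "'a::euclidean_space \<Rightarrow> 'a \<Rightarrow> 'a \<Rightarrow> 'a \<Rightarrow> bool" where
  "is_circumcenter z v w p \<longleftrightarrow>
     norm (p - z) = norm (p - v) \<and> norm (p - v) = norm (p - w) \<and> p \<in> affine hull {z, v, w}"

text \<open>The description of the affine hull by base point and directions, as used for circumcenters.\<close>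
lemma affine_hull_3_base:
  fixes z v w :: "'a::euclidean_space"
  shows "affine hull {z, v, w} = {z + a *\<^sub>R (v - z) + b *\<^sub>R (w - z) | a b. True}"
proof (intro equalityI subsetI)
  fix x assume "x \<in> affine hull {z, v, w}"
  then obtain c a b :: real where "c + a + b = 1" "x = c *\<^sub>R z + a *\<^sub>R v + b *\<^sub>R w"
    by (auto simp: affine_hull_3)
  moreover from this(1) have "c = 1 - a - b" by simp
  ultimately have "x = z + a *\<^sub>R (v - z) + b *\<^sub>R (w - z)"
    by (simp add: algebra_simps)
  then show "x \<in> {z + a *\<^sub>R (v - z) + b *\<^sub>R (w - z) | a b. True}" by blast
next
  fix x assume "x \<in> {z + a *\<^sub>R (v - z) + b *\<^sub>R (w - z) | a b. True}"
  then obtain a b where "x = z + a *\<^sub>R (v - z) + b *\<^sub>R (w - z)" by blast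
  then have "x = (1 - a - b) *\<^sub>R z + a *\<^sub>R v + b *\<^sub>R w"
    by (simp add: algebra_simps)
  moreover have "(1 - a - b) + a + b = 1" by simp
  ultimately show "x \<in> affine hull {z, v, w}"
    unfolding affine_hull_3 by blast
qed

text \<open>Unspecified exactly when the three points are distinct and collinear.\<close>
definition circumcenter :: "'a::euclidean_space \<Rightarrow> 'a \<Rightarrow> 'a \<Rightarrow> 'a" where
  "circumcenter z v w = (THE p. is_circumcenter z v w p)"

definition centralized_point :: "'a::euclidean_space set \<Rightarrow> 'a set \<Rightarrow> 'a \<Rightarrow> 'a" where
  "centralized_point X Y z =
     (let m = closest_point Y (closest_point X z)
      in (1/2) *\<^sub>R (m + closest_point X m))"

definition cCRM :: "'a::euclidean_space set \<Rightarrow> 'a set \<Rightarrow> 'a \<Rightarrow> 'a" where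
  "cCRM X Y z =
     (let c = centralized_point X Y z
      in circumcenter c (reflection X c) (reflection Y c))"

text \<open>\<open>V\<close> is a neighbourhood of \<open>p\<close>, not necessarily open. That \<open>p\<close> lies in \<open>X \<inter> Y\<close> is
  deliberately not part of the predicate, so that using it at the limit of a sequence does not
  presuppose where this limit lies.\<close>
definition error_bound ::
    "'a::euclidean_space set \<Rightarrow> 'a set \<Rightarrow> 'a \<Rightarrow> real \<Rightarrow> 'a set \<Rightarrow> bool" where
  "error_bound X Y p \<omega> V \<longleftrightarrow>
     0 < \<omega> \<and> \<omega> < 1 \<and> p \<in> interior V \<and>
     (\<forall>z\<in>V. \<omega> * infdist z (X \<inter> Y) \<le> max (infdist z X) (infdist z Y))"

text \<open>The value at index 0 (where \<^term>\<open>root 0 x = 0\<close>) does not affect the limes superior.\<close>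
definition asymptotic_constant :: "(nat \<Rightarrow> 'a::real_normed_vector) \<Rightarrow> 'a \<Rightarrow> ereal" where
  "asymptotic_constant w p = limsup (\<lambda>k. ereal (root k (norm (w k - p))))"

definition converges_R_linearly :: "(nat \<Rightarrow> 'a::real_normed_vector) \<Rightarrow> 'a \<Rightarrow> bool" where
  "converges_R_linearly w p \<longleftrightarrow>
     w \<longlonglongrightarrow> p \<and> (\<forall>k. w k \<noteq> p) \<and>
     0 < asymptotic_constant w p \<and> asymptotic_constant w p < 1"

text \<open>The degenerate case, which the open interval in \<^const>\<open>converges_R_linearly\<close> leaves out.
  It occurs for infinite cCRM sequences under the error bound: with
  \<open>X = {(x, y). y \<ge> x\<^sup>2 - 1}\<close> and \<open>Y = {(x, y). y \<le> 0}\<close>, started at \<open>(2, 0)\<close>, the iterates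
  perform Newton-like steps and converge quadratically to \<open>(1, 0)\<close> from outside of \<open>X \<inter> Y\<close>.\<close>
definition converges_R_superlinearly :: "(nat \<Rightarrow> 'a::real_normed_vector) \<Rightarrow> 'a \<Rightarrow> bool" where
  "converges_R_superlinearly w p \<longleftrightarrow>
     w \<longlonglongrightarrow> p \<and> (\<forall>k. w k \<noteq> p) \<and> asymptotic_constant w p = 0"

end

theory Submission
  imports Defs
begin

text \<open>
  Let \<open>S = X \<inter> Y\<close>, let \<open>m\<close> be the alternating projection of \<open>z\<close> and \<open>c\<close> the centralized point,
  the midpoint of \<open>m\<close> and its projection onto \<open>X\<close>. At \<open>c\<close> the two displacements
  \<open>u = P\<^sub>X c - c\<close> and \<open>v = P\<^sub>Y c - c\<close> form an obtuse angle: \<open>m\<close> lies in \<open>Y\<close> and \<open>m - c = - u\<close>,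
  so the variational inequality of \<open>P\<^sub>Y\<close> at \<open>c\<close>, tested with \<open>m\<close>, gives \<open>u \<bullet> v \<le> - v \<bullet> v\<close>.
  The circumcenter of \<open>c\<close> and its two reflections is \<open>c + d\<close> with \<open>d\<close> in the span of \<open>u, v\<close>,
  \<open>d \<bullet> u = u \<bullet> u\<close> and \<open>d \<bullet> v = v \<bullet> v\<close>; obtuseness makes both coefficients of \<open>d\<close> nonnegative,
  so \<open>c + d\<close> is the projection of \<open>c\<close> onto the intersection of the two half-spaces that
  support \<open>X\<close> at \<open>P\<^sub>X c\<close> and \<open>Y\<close> at \<open>P\<^sub>Y c\<close>
  (\<open>circumcenter_of_obtuse_displacements\<close>, \<open>cCRM_step_from_centralized_point\<close>).
  This intersection contains \<open>S\<close>, so the step is Fejer monotone with respect to \<open>S\<close> and its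
  length is at least the larger of the distances from \<open>c\<close> to \<open>X\<close> and \<open>Y\<close>.

  Fejer monotonicity bounds the sequence, the decrease \<open>cCRM_step_decrease\<close> puts every cluster
  point into \<open>S\<close>, and hence the whole sequence converges to a point \<open>p\<close> of \<open>S\<close>.

  Close to \<open>p\<close> the error bound turns the decrease of each of three projection-like steps into a
  contraction of the distance to \<open>S\<close> by \<open>\<beta>\<close> (\<open>infdist_contraction\<close>): from \<open>P\<^sub>X z\<close> to \<open>m\<close>,
  from \<open>m\<close> to \<open>P\<^sub>X m\<close>, and from \<open>c\<close> to the next iterate. The second one contributes
  \<open>(1 + \<beta>) / 2\<close> only, because \<open>c\<close> is the midpoint; together they give \<open>\<beta>\<^sup>2 (1 + \<beta>) / 2\<close>.
  Finally, a Fejer monotone sequence is no farther from its limit than twice its distance to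
  \<open>S\<close>, so the rate for the distances is a rate for the iterates.
\<close>

section \<open>Projections and distances\<close>

lemma infdist_eq_dist_closest_point:
  fixes S :: "'a::euclidean_space set"
  assumes "closed S" "S \<noteq> {}"
  shows "infdist x S = dist x (closest_point S x)"
proof (rule antisym)
  show "infdist x S \<le> dist x (closest_point S x)"
    using assms by (intro infdist_le closest_point_in_set)
  obtain s where "s \<in> S" "infdist x S = dist x s"
    using infdist_attains_inf[OF assms] by metis
  then show "dist x (closest_point S x) \<le> infdist x S"
    using closest_point_le[OF assms(1)] by metis
qed

lemma closest_point_pythagoras:
  fixes C :: "'a::euclidean_space set"
  assumes "convex C" "closed C" "s \<in> C"
  shows "(norm (closest_point C x - s))\<^sup>2 + (infdist x C)\<^sup>2 \<le> (norm (x - s))\<^sup>2"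
proof -
  let ?p = "closest_point C x"
  have "(x - ?p) \<bullet> (s - ?p) \<le> 0"
    using assms by (rule closest_point_dot)
  moreover have "infdist x C = norm (x - ?p)"
    using assms infdist_eq_dist_closest_point by (metis dist_norm empty_iff)
  moreover have "(norm (x - s))\<^sup>2
      = (norm (?p - s))\<^sup>2 + (norm (x - ?p))\<^sup>2 - 2 * ((x - ?p) \<bullet> (s - ?p))"
    unfolding power2_norm_eq_inner by (simp add: inner_diff inner_commute)
  ultimately show ?thesis by simp
qed

lemma closest_point_quasi_nonexpansive:
  fixes C :: "'a::euclidean_space set"
  assumes "convex C" "closed C" "s \<in> C"
  shows "norm (closest_point C x - s) \<le> norm (x - s)"
proof -
  have "(norm (closest_point C x - s))\<^sup>2 \<le> (norm (x - s))\<^sup>2"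
    using closest_point_pythagoras[OF assms, of x] zero_le_power2[of "infdist x C"] by linarith
  then show ?thesis by (rule power2_le_imp_le) simp
qed

lemma closest_point_midpoint:
  fixes C :: "'a::euclidean_space set"
  assumes "convex C" "closed C" "C \<noteq> {}"
  shows "closest_point C (midpoint x (closest_point C x)) = closest_point C x"
proof -
  let ?p = "closest_point C x" and ?c = "midpoint x (closest_point C x)"
  have "dist ?c ?p \<le> dist ?c y" if "y \<in> C" for y
  proof -
    have "dist x ?p \<le> dist x y" using assms(2) that by (rule closest_point_le)
    moreover have "dist x ?c + dist ?c ?p = dist x ?p"
      by (simp add: dist_midpoint)
    ultimately show ?thesis using dist_triangle[of x y ?c] by linarith
  qed
  then show ?thesis
    using assms closest_point_in_set by (metis closest_point_unique)
qed

lemma infdist_midpoint_le: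
  fixes S :: "'a::euclidean_space set"
  assumes "convex S" "closed S" "S \<noteq> {}"
  shows "infdist (midpoint x y) S \<le> (infdist x S + infdist y S) / 2"
proof -
  obtain a where a: "a \<in> S" "infdist x S = dist x a"
    using infdist_attains_inf[OF assms(2,3)] by metis
  obtain b where b: "b \<in> S" "infdist y S = dist y b"
    using infdist_attains_inf[OF assms(2,3)] by metis
  have "midpoint a b \<in> S"
    using assms(1) a(1) b(1) by (metis closed_segment_subset midpoint_in_closed_segment subsetD)
  then have "infdist (midpoint x y) S \<le> dist (midpoint x y) (midpoint a b)"
    by (rule infdist_le)
  also have "midpoint x y - midpoint a b = (1/2) *\<^sub>R ((x - a) + (y - b))"
    by (simp add: midpoint_def algebra_simps)
  then have "dist (midpoint x y) (midpoint a b) = norm ((x - a) + (y - b)) / 2"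
    by (simp add: dist_norm)
  also have "\<dots> \<le> (dist x a + dist y b) / 2"
    using norm_triangle_ineq[of "x - a" "y - b"] by (simp add: dist_norm)
  finally show ?thesis using a b by simp
qed

text \<open>At the point \<open>s\<close> of \<open>S\<close> nearest to \<open>x\<close>, the decrease bounds the squared distance from \<open>y\<close> to
  \<open>S\<close> by that from \<open>x\<close>, less \<open>h\<^sup>2\<close>, of which the bound on \<open>h\<close> makes a fixed proportion.\<close>
lemma infdist_contraction:
  fixes S :: "'a::euclidean_space set"
  assumes "closed S" "S \<noteq> {}" "0 \<le> \<omega>" "\<omega> \<le> 1"
    and bound: "\<omega> * infdist x S \<le> h"
    and decrease: "\<And>s. s \<in> S \<Longrightarrow> (norm (y - s))\<^sup>2 + h\<^sup>2 \<le> (norm (x - s))\<^sup>2"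
  shows "infdist y S \<le> sqrt (1 - \<omega>\<^sup>2) * infdist x S"
proof -
  obtain s where s: "s \<in> S" "infdist x S = dist x s"
    using infdist_attains_inf[OF assms(1,2)] by metis
  have "infdist y S \<le> norm (y - s)"
    using infdist_le[OF s(1), of y] by (simp add: dist_norm)
  then have "(infdist y S)\<^sup>2 \<le> (norm (y - s))\<^sup>2"
    by (intro power_mono infdist_nonneg)
  moreover have "(\<omega> * infdist x S)\<^sup>2 \<le> h\<^sup>2"
    using bound assms(3) by (intro power_mono) (simp_all add: infdist_nonneg)
  moreover have "(norm (x - s))\<^sup>2 = (infdist x S)\<^sup>2"
    using s(2) by (simp add: dist_norm)
  ultimately have "(infdist y S)\<^sup>2 \<le> (1 - \<omega>\<^sup>2) * (infdist x S)\<^sup>2"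
    using decrease[OF s(1)] by (simp add: power_mult_distrib algebra_simps)
  also have "\<dots> = (sqrt (1 - \<omega>\<^sup>2) * infdist x S)\<^sup>2"
    using assms(3,4) by (simp add: power_mult_distrib power_le_one)
  finally show ?thesis
    by (rule power2_le_imp_le) (use assms(3,4) in \<open>simp add: infdist_nonneg power_le_one\<close>)
qed

section \<open>The circumcenter at an obtuse angle\<close>

text \<open>
  The point \<open>e\<close> witnesses that the half-spaces \<open>{x. x \<bullet> u \<ge> u \<bullet> u}\<close> and \<open>{x. x \<bullet> v \<ge> v \<bullet> v}\<close>
  meet. This rules out the only configuration without a circumcenter: at an obtuse angle,
  collinear nonzero \<open>u\<close> and \<open>v\<close> point in opposite directions. Otherwise Cramer's rule yields
  the coefficients, and \<open>u \<bullet> v \<le> 0\<close> makes them nonnegative.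
\<close>
lemma obtuse_displacements_nonneg_solution:
  fixes u v e :: "'a::euclidean_space"
  assumes obtuse: "u \<bullet> v \<le> 0" and eu: "u \<bullet> u \<le> e \<bullet> u" and ev: "v \<bullet> v \<le> e \<bullet> v"
  obtains a b where "0 \<le> a" "0 \<le> b"
    "(a *\<^sub>R u + b *\<^sub>R v) \<bullet> u = u \<bullet> u" "(a *\<^sub>R u + b *\<^sub>R v) \<bullet> v = v \<bullet> v"
proof -
  define D where "D = (u \<bullet> u) * (v \<bullet> v) - (u \<bullet> v)\<^sup>2"
  have D_nonneg: "0 \<le> D"
    using Cauchy_Schwarz_ineq[of u v] by (simp add: D_def)
  consider "u = 0" | "v = 0" | "u \<noteq> 0" "v \<noteq> 0" "D = 0" | "0 < D"
    using D_nonneg by fastforce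
  then show thesis
  proof cases
    case 1
    then show thesis by (intro that[of 0 1]) simp_all
  next
    case 2
    then show thesis by (intro that[of 1 0]) simp_all
  next
    case 3
    have "(norm u * norm v)\<^sup>2 = (u \<bullet> v)\<^sup>2"
      using 3(3) by (simp add: D_def power_mult_distrib power2_norm_eq_inner)
    then have "norm u * norm v = \<bar>u \<bullet> v\<bar>"
      by (simp add: power2_eq_imp_eq)
    then have "(- u) \<bullet> v = norm (- u) * norm v"
      using obtuse by simp
    then have "norm u *\<^sub>R v = norm v *\<^sub>R (- u)"
      by (metis norm_cauchy_schwarz_eq norm_minus_cancel)
    from arg_cong[OF this, of "\<lambda>w. e \<bullet> w"]
    have "norm u * (e \<bullet> v) = - norm v * (e \<bullet> u)" by simp
    moreover have "0 < norm u * (e \<bullet> v)"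
      using 3(1,2) ev by (smt (verit) inner_gt_zero_iff mult_pos_pos zero_less_norm_iff)
    moreover have "0 < norm v * (e \<bullet> u)"
      using 3(1,2) eu by (smt (verit) inner_gt_zero_iff mult_pos_pos zero_less_norm_iff)
    ultimately show thesis by simp
  next
    case 4
    show thesis
    proof (rule that)
      let ?a = "(v \<bullet> v) * (u \<bullet> u - u \<bullet> v) / D" and ?b = "(u \<bullet> u) * (v \<bullet> v - u \<bullet> v) / D"
      show "0 \<le> ?a"
        using 4 obtuse by (intro divide_nonneg_pos mult_nonneg_nonneg) (simp_all add: order_trans[OF obtuse])
      show "0 \<le> ?b"
        using 4 obtuse by (intro divide_nonneg_pos mult_nonneg_nonneg) (simp_all add: order_trans[OF obtuse])
      have "(?a *\<^sub>R u + ?b *\<^sub>R v) \<bullet> u = (u \<bullet> u) * D / D"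
        unfolding inner_add_left inner_scaleR_left inner_commute[of v u]
          times_divide_eq_left add_divide_distrib[symmetric]
        by (rule arg_cong[where f = "\<lambda>t. t / D"]) (simp add: D_def power2_eq_square algebra_simps)
      then show "(?a *\<^sub>R u + ?b *\<^sub>R v) \<bullet> u = u \<bullet> u" using 4 by simp
      have "(?a *\<^sub>R u + ?b *\<^sub>R v) \<bullet> v = (v \<bullet> v) * D / D"
        unfolding inner_add_left inner_scaleR_left inner_commute[of v u]
          times_divide_eq_left add_divide_distrib[symmetric]
        by (rule arg_cong[where f = "\<lambda>t. t / D"]) (simp add: D_def power2_eq_square algebra_simps)
      then show "(?a *\<^sub>R u + ?b *\<^sub>R v) \<bullet> v = v \<bullet> v" using 4 by simp
    qed
  qed
qed

lemma norm_eq_norm_diff_double_iff: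
  fixes d u :: "'a::real_inner"
  shows "norm d = norm (d - 2 *\<^sub>R u) \<longleftrightarrow> d \<bullet> u = u \<bullet> u"
  unfolding norm_eq by (simp add: inner_diff inner_commute) (auto simp: algebra_simps)

text \<open>
  Equidistance says that the displacement from \<open>c\<close> has prescribed inner products with \<open>u\<close> and \<open>v\<close>, which determines
  it within their span. This covers coinciding points as well.
\<close>
lemma circumcenter_eqI:
  fixes c u v :: "'a::euclidean_space"
  assumes d: "d = a *\<^sub>R u + b *\<^sub>R v" and du: "d \<bullet> u = u \<bullet> u" and dv: "d \<bullet> v = v \<bullet> v"
  shows "circumcenter c (c + 2 *\<^sub>R u) (c + 2 *\<^sub>R v) = c + d"
proof -
  have equidistant: "norm (p - c) = norm (p - (c + 2 *\<^sub>R u)) \<and>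
      norm (p - (c + 2 *\<^sub>R u)) = norm (p - (c + 2 *\<^sub>R v)) \<longleftrightarrow>
      (p - c) \<bullet> u = u \<bullet> u \<and> (p - c) \<bullet> v = v \<bullet> v" for p
    using norm_eq_norm_diff_double_iff[of "p - c" u] norm_eq_norm_diff_double_iff[of "p - c" v]
    by (auto simp: diff_diff_eq)
  have "c + d \<in> affine hull {c, c + 2 *\<^sub>R u, c + 2 *\<^sub>R v}"
    unfolding affine_hull_3_base
    by (rule CollectI, rule exI[of _ "a / 2"], rule exI[of _ "b / 2"]) (simp add: d)
  then have is_cc: "is_circumcenter c (c + 2 *\<^sub>R u) (c + 2 *\<^sub>R v) (c + d)"
    using equidistant[of "c + d"] du dv unfolding is_circumcenter_def by simp
  have "p = c + d" if p: "is_circumcenter c (c + 2 *\<^sub>R u) (c + 2 *\<^sub>R v) p" for p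
  proof -
    obtain a' b' where "p = c + a' *\<^sub>R (2 *\<^sub>R u) + b' *\<^sub>R (2 *\<^sub>R v)"
      using p unfolding is_circumcenter_def affine_hull_3_base by auto
    then have e: "p - c - d = (2 * a' - a) *\<^sub>R u + (2 * b' - b) *\<^sub>R v"
      by (simp add: d algebra_simps)
    have "(p - c) \<bullet> u = u \<bullet> u" "(p - c) \<bullet> v = v \<bullet> v"
      using p equidistant[of p] unfolding is_circumcenter_def by auto
    then have "(p - c - d) \<bullet> u = 0" "(p - c - d) \<bullet> v = 0"
      using du dv by (simp_all add: inner_diff_left)
    then have "(p - c - d) \<bullet> (p - c - d) = 0"
      by (subst (2) e) (simp add: inner_add_right)
    then have "p - c - d = 0" by (simp only: inner_eq_zero_iff)
    then show ?thesis by (simp add: algebra_simps)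
  qed
  then show ?thesis
    unfolding circumcenter_def using is_cc by (rule the_equality[rotated])
qed

text \<open>
  The circumcenter behaves like the projection of \<open>c\<close> onto the intersection of two half-spaces
  that contain \<open>S\<close>: its displacement \<open>d\<close> from \<open>c\<close> is a combination of \<open>u\<close> and \<open>v\<close> with
  nonnegative coefficients, whence \<open>(s - c) \<bullet> d \<ge> d \<bullet> d\<close> for every \<open>s\<close> in \<open>S\<close>. It is at least
  as long as \<open>u\<close> and \<open>v\<close>, which are its projections onto their own directions.
\<close>
lemma circumcenter_of_obtuse_displacements:
  fixes c u v :: "'a::euclidean_space"
  assumes obtuse: "u \<bullet> v \<le> 0" and "S \<noteq> {}"
    and su: "\<And>s. s \<in> S \<Longrightarrow> u \<bullet> u \<le> (s - c) \<bullet> u"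
    and sv: "\<And>s. s \<in> S \<Longrightarrow> v \<bullet> v \<le> (s - c) \<bullet> v"
  defines "t \<equiv> circumcenter c (c + 2 *\<^sub>R u) (c + 2 *\<^sub>R v)"
  shows "\<And>s. s \<in> S \<Longrightarrow> (norm (t - s))\<^sup>2 + (norm (t - c))\<^sup>2 \<le> (norm (c - s))\<^sup>2"
    and "norm u \<le> norm (t - c)" and "norm v \<le> norm (t - c)"
proof -
  obtain s0 where s0: "s0 \<in> S" using \<open>S \<noteq> {}\<close> by blast
  obtain a b where ab: "0 \<le> a" "0 \<le> b"
    "(a *\<^sub>R u + b *\<^sub>R v) \<bullet> u = u \<bullet> u" "(a *\<^sub>R u + b *\<^sub>R v) \<bullet> v = v \<bullet> v"
    using obtuse_displacements_nonneg_solution[OF obtuse su[OF s0] sv[OF s0]] .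
  define d where "d = a *\<^sub>R u + b *\<^sub>R v"
  have du: "d \<bullet> u = u \<bullet> u" and dv: "d \<bullet> v = v \<bullet> v"
    using ab by (simp_all add: d_def)
  have t: "t = c + d"
    unfolding t_def using d_def du dv by (rule circumcenter_eqI)
  show "(norm (t - s))\<^sup>2 + (norm (t - c))\<^sup>2 \<le> (norm (c - s))\<^sup>2" if "s \<in> S" for s
  proof -
    have "d \<bullet> d = a * (u \<bullet> u) + b * (v \<bullet> v)"
      by (subst (2) d_def) (simp add: inner_add_right du dv)
    also have "\<dots> \<le> a * ((s - c) \<bullet> u) + b * ((s - c) \<bullet> v)"
      using su[OF that] sv[OF that] ab by (intro add_mono mult_left_mono)
    also have "\<dots> = (s - c) \<bullet> d"
      by (simp add: d_def inner_add_right)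
    finally have "d \<bullet> d \<le> (s - c) \<bullet> d" .
    moreover have "(norm (t - s))\<^sup>2 = (norm (c - s))\<^sup>2 - 2 * ((s - c) \<bullet> d) + d \<bullet> d"
      unfolding power2_norm_eq_inner t
      by (simp add: inner_diff inner_add inner_commute algebra_simps)
    ultimately show ?thesis by (simp add: t power2_norm_eq_inner)
  qed
  have norm_le: "norm w \<le> norm d" if "d \<bullet> w = w \<bullet> w" for w
  proof (cases "w = 0")
    case False
    have "norm w * norm w \<le> norm d * norm w"
      using norm_cauchy_schwarz[of d w] that by (simp add: dot_square_norm power2_eq_square)
    then show ?thesis using False by simp
  qed simp
  show "norm u \<le> norm (t - c)" "norm v \<le> norm (t - c)"
    using norm_le[OF du] norm_le[OF dv] by (simp_all add: t)
qed

section \<open>One step of the method\<close>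

lemma closest_point_supporting_halfspace:
  fixes C :: "'a::euclidean_space set" and c :: 'a
  assumes "convex C" "closed C" "s \<in> C"
  defines "u \<equiv> closest_point C c - c"
  shows "u \<bullet> u \<le> (s - c) \<bullet> u"
proof -
  have "(c - closest_point C c) \<bullet> (s - closest_point C c) \<le> 0"
    using assms(1-3) by (rule closest_point_dot)
  then show ?thesis
    unfolding u_def by (simp add: inner_diff inner_commute)
qed

lemma centralized_point_eq_midpoint:
  "centralized_point X Y z =
     midpoint (closest_point Y (closest_point X z))
       (closest_point X (closest_point Y (closest_point X z)))"
  by (simp add: centralized_point_def Let_def midpoint_def)

text \<open>
  The point of \<open>Y\<close> from which the midpoint is formed lies opposite to \<open>P\<^sub>X c\<close>, as seen from
  \<open>c\<close>, hence it forces the displacement towards \<open>Y\<close> away from the one towards \<open>X\<close>.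
\<close>
lemma centralized_point_obtuse:
  fixes X Y :: "'a::euclidean_space set" and z :: 'a
  assumes "closed X" "convex X" "closed Y" "convex Y" "X \<inter> Y \<noteq> {}"
  defines "c \<equiv> centralized_point X Y z"
  shows "(closest_point X c - c) \<bullet> (closest_point Y c - c) \<le> 0"
proof -
  define m where "m = closest_point Y (closest_point X z)"
  have c: "c = midpoint m (closest_point X m)"
    by (simp add: c_def m_def centralized_point_eq_midpoint)
  have "X \<noteq> {}" "Y \<noteq> {}" using assms(5) by auto
  then have "closest_point X c = closest_point X m"
    unfolding c using assms closest_point_midpoint by blast
  moreover have "c + c = m + closest_point X m"
    by (simp add: c)
  ultimately have m_eq: "m - c = - (closest_point X c - c)"
    by (simp add: algebra_simps)
  have "m \<in> Y"
    unfolding m_def using assms \<open>Y \<noteq> {}\<close> by (simp add: closest_point_in_set)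
  from closest_point_supporting_halfspace[OF assms(4,3) this, of c]
  have "0 \<le> (m - c) \<bullet> (closest_point Y c - c)"
    using inner_ge_zero order_trans by blast
  then show ?thesis unfolding m_eq inner_minus_left by linarith
qed

lemma cCRM_step_from_centralized_point:
  fixes X Y :: "'a::euclidean_space set" and z :: 'a
  assumes "closed X" "convex X" "closed Y" "convex Y" "X \<inter> Y \<noteq> {}"
  defines "c \<equiv> centralized_point X Y z"
  shows "\<And>s. s \<in> X \<inter> Y \<Longrightarrow>
      (norm (cCRM X Y z - s))\<^sup>2 + (norm (cCRM X Y z - c))\<^sup>2 \<le> (norm (c - s))\<^sup>2"
    and "max (infdist c X) (infdist c Y) \<le> norm (cCRM X Y z - c)"
proof -
  define u where "u = closest_point X c - c"
  define v where "v = closest_point Y c - c"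
  have t: "cCRM X Y z = circumcenter c (c + 2 *\<^sub>R u) (c + 2 *\<^sub>R v)"
    unfolding cCRM_def Let_def c_def[symmetric] reflection_def u_def v_def
    by (simp add: algebra_simps scaleR_2)
  have obtuse: "u \<bullet> v \<le> 0"
    unfolding u_def v_def c_def using assms(1-5) by (rule centralized_point_obtuse)
  have su: "u \<bullet> u \<le> (s - c) \<bullet> u" and sv: "v \<bullet> v \<le> (s - c) \<bullet> v" if "s \<in> X \<inter> Y" for s
    unfolding u_def v_def using assms(1-4) that
    by (auto intro: closest_point_supporting_halfspace)
  show "(norm (cCRM X Y z - s))\<^sup>2 + (norm (cCRM X Y z - c))\<^sup>2 \<le> (norm (c - s))\<^sup>2"
    if "s \<in> X \<inter> Y" for s
    unfolding t
    by (rule circumcenter_of_obtuse_displacements(1)[OF obtuse assms(5) _ _ that])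
       (simp_all add: su sv)
  have "infdist c X = norm u" "infdist c Y = norm v"
    unfolding u_def v_def dist_norm[symmetric] dist_commute[of _ c] using assms(1,3,5)
    by (blast intro: infdist_eq_dist_closest_point)+
  moreover have "norm u \<le> norm (cCRM X Y z - c)"
    unfolding t by (rule circumcenter_of_obtuse_displacements(2)[OF obtuse assms(5)])
      (simp_all add: su sv)
  moreover have "norm v \<le> norm (cCRM X Y z - c)"
    unfolding t by (rule circumcenter_of_obtuse_displacements(3)[OF obtuse assms(5)])
      (simp_all add: su sv)
  ultimately show "max (infdist c X) (infdist c Y) \<le> norm (cCRM X Y z - c)"
    by simp
qed

lemma norm_centralized_point_le:
  fixes X Y :: "'a::euclidean_space set"
  assumes "closed X" "convex X" "s \<in> X"
  shows "norm (centralized_point X Y z - s) \<le> norm (closest_point Y (closest_point X z) - s)"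
proof -
  define m where "m = closest_point Y (closest_point X z)"
  have "centralized_point X Y z + centralized_point X Y z = m + closest_point X m"
    by (simp add: m_def centralized_point_eq_midpoint)
  then have "2 *\<^sub>R (centralized_point X Y z - s) = (m - s) + (closest_point X m - s)"
    by (simp add: scaleR_2 algebra_simps)
  from arg_cong[OF this, of norm] have "norm (centralized_point X Y z - s) = norm ((m - s) + (closest_point X m - s)) / 2"
    by simp
  also have "\<dots> \<le> (norm (m - s) + norm (closest_point X m - s)) / 2"
    using norm_triangle_ineq by (intro divide_right_mono) auto
  also have "\<dots> \<le> norm (m - s)"
    using closest_point_quasi_nonexpansive[OF assms(2,1,3), of m] by simp
  finally show ?thesis by (simp add: m_def)
qed

text \<open>
  The two distances on the left vanish together only if \<open>z\<close> belongs to \<open>X \<inter> Y\<close>, which is what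
  identifies cluster points of the iteration.
\<close>
lemma cCRM_step_decrease:
  fixes X Y :: "'a::euclidean_space set"
  assumes "closed X" "convex X" "closed Y" "convex Y" "s \<in> X \<inter> Y"
  shows "(norm (cCRM X Y z - s))\<^sup>2 + (infdist (closest_point X z) Y)\<^sup>2 + (infdist z X)\<^sup>2
    \<le> (norm (z - s))\<^sup>2"
proof -
  define c where "c = centralized_point X Y z"
  define m where "m = closest_point Y (closest_point X z)"
  have nonempty: "X \<inter> Y \<noteq> {}" using assms(5) by blast
  have "(norm (cCRM X Y z - s))\<^sup>2 \<le> (norm (c - s))\<^sup>2"
    using cCRM_step_from_centralized_point(1)[OF assms(1-4) nonempty assms(5), of z, folded c_def]
      zero_le_power2[of "norm (cCRM X Y z - c)"] by linarith
  also have "\<dots> \<le> (norm (m - s))\<^sup>2"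
    unfolding c_def m_def using assms by (intro power_mono norm_centralized_point_le) auto
  also have "\<dots> + (infdist (closest_point X z) Y)\<^sup>2 \<le> (norm (closest_point X z - s))\<^sup>2"
    unfolding m_def using assms by (intro closest_point_pythagoras) auto
  also have "\<dots> + (infdist z X)\<^sup>2 \<le> (norm (z - s))\<^sup>2"
    using assms by (intro closest_point_pythagoras) auto
  finally show ?thesis by simp
qed

lemma cCRM_step_fejer:
  fixes X Y :: "'a::euclidean_space set"
  assumes "closed X" "convex X" "closed Y" "convex Y" "s \<in> X \<inter> Y"
  shows "norm (cCRM X Y z - s) \<le> norm (z - s)"
proof (rule power2_le_imp_le)
  show "(norm (cCRM X Y z - s))\<^sup>2 \<le> (norm (z - s))\<^sup>2"
    using cCRM_step_decrease[OF assms, of z] zero_le_power2[of "infdist z X"]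
      zero_le_power2[of "infdist (closest_point X z) Y"] by linarith
qed simp

text \<open>
  The error bound is used at \<open>P\<^sub>X z\<close>, at \<open>m\<close> and at \<open>c\<close>. For the first two the maximum is the
  distance to the other set, so that the following projection travels far enough. At \<open>z\<close> itself
  the maximum might be the distance to \<open>Y\<close>, and projecting onto \<open>X\<close> need not make any progress.
\<close>
lemma cCRM_step_contraction:
  fixes X Y :: "'a::euclidean_space set"
  assumes "closed X" "convex X" "closed Y" "convex Y" "p \<in> X \<inter> Y" "0 \<le> \<omega>" "\<omega> \<le> 1"
    and eb: "\<And>x. norm (x - p) \<le> norm (z - p) \<Longrightarrow>
      \<omega> * infdist x (X \<inter> Y) \<le> max (infdist x X) (infdist x Y)"
  defines "\<beta> \<equiv> sqrt (1 - \<omega>\<^sup>2)"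
  shows "infdist (cCRM X Y z) (X \<inter> Y) \<le> \<beta>\<^sup>2 * ((1 + \<beta>) / 2) * infdist z (X \<inter> Y)"
proof -
  define S where "S = X \<inter> Y"
  define c where "c = centralized_point X Y z"
  define x where "x = closest_point X z"
  define m where "m = closest_point Y x"
  have S: "closed S" "convex S" "S \<noteq> {}" and "X \<noteq> {}" "Y \<noteq> {}"
    using assms(1-5) by (auto simp: S_def convex_Int)
  have p: "p \<in> X" "p \<in> Y" using assms(5) by auto
  have "x \<in> X" "m \<in> Y"
    unfolding x_def m_def using assms(1,3) \<open>X \<noteq> {}\<close> \<open>Y \<noteq> {}\<close> by (auto intro: closest_point_in_set)
  have near_x: "norm (x - p) \<le> norm (z - p)"
    unfolding x_def using assms p by (intro closest_point_quasi_nonexpansive)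
  have "norm (m - p) \<le> norm (x - p)"
    unfolding m_def using assms p by (intro closest_point_quasi_nonexpansive)
  with near_x have near_m: "norm (m - p) \<le> norm (z - p)" by linarith
  have near_c: "norm (c - p) \<le> norm (z - p)"
    using norm_centralized_point_le[OF assms(1,2) p(1), of Y z] near_m
    unfolding c_def m_def x_def by linarith
  have \<beta>: "0 \<le> \<beta>" using assms(6,7) by (simp add: \<beta>_def power_le_one)
  have "infdist x S \<le> infdist z S"
  proof -
    obtain s where s: "s \<in> S" "infdist z S = dist z s"
      using infdist_attains_inf[OF S(1,3)] by metis
    have "infdist x S \<le> dist x s" using s(1) by (rule infdist_le)
    also have "\<dots> \<le> dist z s"
      unfolding dist_norm x_def using assms(1,2) s(1)
      by (intro closest_point_quasi_nonexpansive) (auto simp: S_def)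
    finally show ?thesis using s(2) by simp
  qed
  moreover have "infdist m S \<le> \<beta> * infdist x S"
    unfolding \<beta>_def
  proof (rule infdist_contraction[OF S(1,3) assms(6,7)])
    show "\<omega> * infdist x S \<le> infdist x Y"
      using eb[OF near_x] \<open>x \<in> X\<close> by (simp add: S_def infdist_nonneg max_def)
    show "(norm (m - s))\<^sup>2 + (infdist x Y)\<^sup>2 \<le> (norm (x - s))\<^sup>2" if "s \<in> S" for s
      unfolding m_def using assms that by (intro closest_point_pythagoras) (auto simp: S_def)
  qed
  ultimately have m: "infdist m S \<le> \<beta> * infdist z S"
    using \<beta> by (meson mult_left_mono order_trans)
  have Xm: "infdist (closest_point X m) S \<le> \<beta> * infdist m S"
    unfolding \<beta>_def
  proof (rule infdist_contraction[OF S(1,3) assms(6,7)])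
    show "\<omega> * infdist m S \<le> infdist m X"
      using eb[OF near_m] \<open>m \<in> Y\<close> infdist_nonneg[of m X] by (simp add: S_def max_def split: if_splits)
    show "(norm (closest_point X m - s))\<^sup>2 + (infdist m X)\<^sup>2 \<le> (norm (m - s))\<^sup>2" if "s \<in> S" for s
      using assms that by (intro closest_point_pythagoras) (auto simp: S_def)
  qed
  have "c = midpoint m (closest_point X m)"
    by (simp add: c_def m_def x_def centralized_point_eq_midpoint)
  then have "infdist c S \<le> (infdist m S + infdist (closest_point X m) S) / 2"
    using infdist_midpoint_le[OF S(2,1,3)] by simp
  also have "\<dots> \<le> (1 + \<beta>) / 2 * infdist m S"
    using Xm by (simp add: field_simps)
  also have "\<dots> \<le> (1 + \<beta>) / 2 * (\<beta> * infdist z S)"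
    using m \<beta> by (intro mult_left_mono) auto
  finally have c: "infdist c S \<le> (1 + \<beta>) / 2 * (\<beta> * infdist z S)" .
  have "infdist (cCRM X Y z) S \<le> \<beta> * infdist c S"
    unfolding \<beta>_def
  proof (rule infdist_contraction[OF S(1,3) assms(6,7)])
    show "\<omega> * infdist c S \<le> norm (cCRM X Y z - c)"
      using eb[OF near_c] cCRM_step_from_centralized_point(2)[OF assms(1-4), of z] S(3)
      unfolding S_def c_def by linarith
    show "(norm (cCRM X Y z - s))\<^sup>2 + (norm (cCRM X Y z - c))\<^sup>2 \<le> (norm (c - s))\<^sup>2"
      if "s \<in> S" for s
      unfolding c_def using assms(1-5) that
      by (intro cCRM_step_from_centralized_point(1)) (auto simp: S_def)
  qed
  also have "\<dots> \<le> \<beta> * ((1 + \<beta>) / 2 * (\<beta> * infdist z S))"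
    using c \<beta> by (rule mult_left_mono)
  finally show ?thesis
    by (simp add: S_def power2_eq_square algebra_simps)
qed

section \<open>Fejer monotone sequences and convergence\<close>

lemma fejer_monotone_le:
  fixes w :: "nat \<Rightarrow> 'a::real_normed_vector"
  assumes "\<And>k. norm (w (Suc k) - s) \<le> norm (w k - s)" "k \<le> l"
  shows "norm (w l - s) \<le> norm (w k - s)"
  using lift_Suc_antimono_le[of "\<lambda>k. norm (w k - s)", OF assms(1) assms(2)] .

lemma fejer_monotone_tendsto_cluster_point:
  fixes w :: "nat \<Rightarrow> 'a::real_normed_vector"
  assumes fejer: "\<And>k. norm (w (Suc k) - p) \<le> norm (w k - p)"
    and "strict_mono \<sigma>" "(w \<circ> \<sigma>) \<longlonglongrightarrow> p"
  shows "w \<longlonglongrightarrow> p"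
proof (rule LIMSEQ_I)
  fix e :: real assume "0 < e"
  then obtain j where "norm (w (\<sigma> j) - p) < e"
    using LIMSEQ_D[OF assms(3)] by fastforce
  then have "norm (w k - p) < e" if "\<sigma> j \<le> k" for k
    using fejer_monotone_le[of w p, OF fejer that] by linarith
  then show "\<exists>K. \<forall>k\<ge>K. norm (w k - p) < e" by blast
qed

text \<open>The limit stays in the ball around the projection \<open>s\<close> of \<open>w k\<close> onto \<open>S\<close> with \<open>w k\<close> on
  its boundary, a ball of diameter twice the distance from \<open>w k\<close> to \<open>S\<close>.\<close>
lemma fejer_monotone_dist_limit_le:
  fixes w :: "nat \<Rightarrow> 'a::euclidean_space"
  assumes "closed S" "S \<noteq> {}"
    and fejer: "\<And>s k. s \<in> S \<Longrightarrow> norm (w (Suc k) - s) \<le> norm (w k - s)"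
    and "w \<longlonglongrightarrow> p"
  shows "norm (w k - p) \<le> 2 * infdist (w k) S"
proof -
  obtain s where s: "s \<in> S" "infdist (w k) S = dist (w k) s"
    using infdist_attains_inf[OF assms(1,2)] by metis
  have "(\<lambda>l. norm (w l - s)) \<longlonglongrightarrow> norm (p - s)"
    using assms(4) by (intro tendsto_intros)
  moreover have "\<forall>\<^sub>F l in sequentially. norm (w l - s) \<le> norm (w k - s)"
    using eventually_ge_at_top[of k]
    by eventually_elim (rule fejer_monotone_le[of w s, OF fejer[OF s(1)]])
  ultimately have "norm (p - s) \<le> norm (w k - s)"
    by (rule tendsto_upperbound) simp
  moreover have "norm (w k - p) \<le> norm (w k - s) + norm (p - s)"
    by (metis dist_norm dist_triangle2)
  ultimately show ?thesis using s(2) by (simp add: dist_norm)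
qed

text \<open>
  The squared distances to a point of \<open>X \<inter> Y\<close> decrease and converge, so their decrements
  tend to zero, and with them the distances in \<open>cCRM_step_decrease\<close>. Hence a cluster point,
  which exists by boundedness, belongs to both sets.
\<close>
lemma cCRM_converges:
  fixes X Y :: "'a::euclidean_space set"
  assumes "closed X" "convex X" "closed Y" "convex Y" "X \<inter> Y \<noteq> {}"
    and step: "\<And>k. z (Suc k) = cCRM X Y (z k)"
  obtains p where "p \<in> X \<inter> Y" "z \<longlonglongrightarrow> p"
proof -
  have decrease: "(norm (z (Suc k) - s))\<^sup>2 + (infdist (closest_point X (z k)) Y)\<^sup>2
      + (infdist (z k) X)\<^sup>2 \<le> (norm (z k - s))\<^sup>2" if "s \<in> X \<inter> Y" for s k
    unfolding step using assms(1-4) that by (rule cCRM_step_decrease)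
  have fejer: "norm (z (Suc k) - s) \<le> norm (z k - s)" if "s \<in> X \<inter> Y" for s k
    unfolding assms(6) using assms(1-4) that by (rule cCRM_step_fejer)
  obtain s where s: "s \<in> X \<inter> Y" using assms(5) by blast
  have "decseq (\<lambda>k. (norm (z k - s))\<^sup>2)"
    using fejer[OF s] by (intro decseq_SucI power_mono) auto
  then obtain L where L: "(\<lambda>k. (norm (z k - s))\<^sup>2) \<longlonglongrightarrow> L"
    using decseq_convergent[of "\<lambda>k. (norm (z k - s))\<^sup>2" 0] by auto
  have gap: "(\<lambda>k. (norm (z k - s))\<^sup>2 - (norm (z (Suc k) - s))\<^sup>2) \<longlonglongrightarrow> 0"
    using tendsto_diff[OF L LIMSEQ_Suc[OF L]] by simp
  have vanish: "f \<longlonglongrightarrow> 0"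
    if "\<And>k. 0 \<le> f k" "\<And>k. (f k)\<^sup>2 \<le> (norm (z k - s))\<^sup>2 - (norm (z (Suc k) - s))\<^sup>2"
    for f :: "nat \<Rightarrow> real"
  proof -
    have "(\<lambda>k. (f k)\<^sup>2) \<longlonglongrightarrow> 0"
      by (rule tendsto_sandwich[OF _ _ tendsto_const gap]) (use that(2) in auto)
    then show ?thesis by simp
  qed
  have dX: "(\<lambda>k. infdist (z k) X) \<longlonglongrightarrow> 0"
  proof (rule vanish)
    show "(infdist (z k) X)\<^sup>2 \<le> (norm (z k - s))\<^sup>2 - (norm (z (Suc k) - s))\<^sup>2" for k
      using decrease[OF s, of k] zero_le_power2[of "infdist (closest_point X (z k)) Y"] by linarith
  qed (rule infdist_nonneg)
  have dY: "(\<lambda>k. infdist (closest_point X (z k)) Y) \<longlonglongrightarrow> 0"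
  proof (rule vanish)
    show "(infdist (closest_point X (z k)) Y)\<^sup>2 \<le> (norm (z k - s))\<^sup>2 - (norm (z (Suc k) - s))\<^sup>2"
      for k
      using decrease[OF s, of k] zero_le_power2[of "infdist (z k) X"] by linarith
  qed (rule infdist_nonneg)
  have "z k \<in> cball s (norm (z 0 - s))" for k
    using fejer_monotone_le[of z s 0 k, OF fejer[OF s]] by (simp add: dist_norm norm_minus_commute)
  then obtain p \<sigma> where \<sigma>: "strict_mono \<sigma>" "(z \<circ> \<sigma>) \<longlonglongrightarrow> p"
    using compact_cball[of s "norm (z 0 - s)"] unfolding compact_eq_seq_compact_metric seq_compact_def
    by metis
  have nonempty: "X \<noteq> {}" "Y \<noteq> {}" using assms(5) by auto
  have "(\<lambda>k. infdist ((z \<circ> \<sigma>) k) X) \<longlonglongrightarrow> infdist p X"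
    using \<sigma>(2) by (rule tendsto_infdist)
  moreover have "(\<lambda>k. infdist ((z \<circ> \<sigma>) k) X) \<longlonglongrightarrow> 0"
    using LIMSEQ_subseq_LIMSEQ[OF dX \<sigma>(1)] by (simp add: o_def)
  ultimately have "infdist p X = 0" using LIMSEQ_unique by blast
  then have pX: "p \<in> X" using assms(1) nonempty by (simp add: in_closed_iff_infdist_zero)
  have "(\<lambda>k. closest_point X ((z \<circ> \<sigma>) k)) \<longlonglongrightarrow> closest_point X p"
    using continuous_at_closest_point[OF assms(2,1) nonempty(1)] \<sigma>(2)
    by (rule isCont_tendsto_compose)
  then have "(\<lambda>k. infdist (closest_point X ((z \<circ> \<sigma>) k)) Y) \<longlonglongrightarrow> infdist p Y"
    using pX by (simp add: closest_point_self tendsto_infdist)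
  moreover have "(\<lambda>k. infdist (closest_point X ((z \<circ> \<sigma>) k)) Y) \<longlonglongrightarrow> 0"
    using LIMSEQ_subseq_LIMSEQ[OF dY \<sigma>(1)] by (simp add: o_def)
  ultimately have "infdist p Y = 0" using LIMSEQ_unique by blast
  then have "p \<in> Y" using assms(3) nonempty by (simp add: in_closed_iff_infdist_zero)
  with pX have p: "p \<in> X \<inter> Y" by simp
  moreover have "z \<longlonglongrightarrow> p"
    using fejer[OF p] \<sigma> by (rule fejer_monotone_tendsto_cluster_point)
  ultimately show thesis by (rule that)
qed

section \<open>Asymptotic constants\<close>

lemma asymptotic_constant_nonneg: "0 \<le> asymptotic_constant w p"
proof -
  have "limsup (\<lambda>k. 0 :: ereal) \<le> asymptotic_constant w p"
    unfolding asymptotic_constant_def by (rule Limsup_mono) (simp add: real_root_ge_zero)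
  then show ?thesis by (simp add: Limsup_const)
qed

lemma asymptotic_constant_le_geometric:
  assumes "0 < C" "0 \<le> q" "\<forall>\<^sub>F k in sequentially. norm (w k - p) \<le> C * q ^ k"
  shows "asymptotic_constant w p \<le> ereal q"
proof -
  have "asymptotic_constant w p \<le> limsup (\<lambda>k. ereal (root k C * q))"
    unfolding asymptotic_constant_def
  proof (rule Limsup_mono)
    show "\<forall>\<^sub>F k in sequentially. ereal (root k (norm (w k - p))) \<le> ereal (root k C * q)"
      using assms(3) eventually_gt_at_top[of 0]
    proof eventually_elim
      case (elim k)
      then have "root k (norm (w k - p)) \<le> root k (C * q ^ k)" by simp
      also have "\<dots> = root k C * q"
        using elim(2) assms(2) by (simp add: real_root_mult real_root_power_cancel)
      finally show ?case by simp
    qed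
  qed
  also have "(\<lambda>k. root k C * q) \<longlonglongrightarrow> 1 * q"
    using LIMSEQ_root_const[OF assms(1)] by (intro tendsto_intros)
  then have "(\<lambda>k. ereal (root k C * q)) \<longlonglongrightarrow> ereal q"
    by simp
  then have "limsup (\<lambda>k. ereal (root k C * q)) = ereal q"
    by (intro lim_imp_Limsup) simp_all
  finally show ?thesis .
qed

lemma eventual_contraction_geometric_bound:
  fixes f :: "nat \<Rightarrow> real"
  assumes "0 < q" "\<And>k. 0 \<le> f k" "\<forall>\<^sub>F k in sequentially. f (Suc k) \<le> q * f k"
  obtains C where "0 < C" "\<forall>\<^sub>F k in sequentially. f k \<le> C * q ^ k"
proof -
  obtain K where K: "\<And>k. K \<le> k \<Longrightarrow> f (Suc k) \<le> q * f k"
    using assms(3) unfolding eventually_sequentially by blast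
  \<comment> \<open>The summand 1 keeps the constant positive if \<open>f\<close> vanishes at \<open>K\<close>.\<close>
  define C where "C = (f K + 1) / q ^ K"
  have "f k \<le> C * q ^ k" if "K \<le> k" for k
    using that
  proof (induction k rule: dec_induct)
    case base
    then show ?case using assms(1) by (simp add: C_def)
  next
    case (step k)
    have "f (Suc k) \<le> q * f k" using step.hyps K by simp
    also have "\<dots> \<le> q * (C * q ^ k)" using step.IH assms(1) by (intro mult_left_mono) auto
    finally show ?case by (simp add: mult.left_commute)
  qed
  then have "\<forall>\<^sub>F k in sequentially. f k \<le> C * q ^ k"
    unfolding eventually_sequentially by blast
  moreover have "0 < C" using assms(1) assms(2)[of K] by (simp add: C_def add_nonneg_pos)
  ultimately show thesis by (rule that[rotated])
qed

section \<open>The rate under an error bound\<close>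

theorem theorem3p10:
  fixes X Y V :: "(real ^ 'n) set" and z :: "nat \<Rightarrow> real ^ 'n" and \<omega> \<beta> :: real
  assumes "closed X" and "convex X" and "closed Y" and "convex Y"
    and "X \<inter> Y \<noteq> {}"
    and "\<And>k. z (Suc k) = cCRM X Y (z k)"
    and "\<And>k. z k \<notin> X \<inter> Y"
    and "error_bound X Y (lim z) \<omega> V"
    and "\<beta> = sqrt (1 - \<omega>\<^sup>2)"
  shows "\<exists>p \<in> X \<inter> Y.
           (converges_R_linearly z p \<or> converges_R_superlinearly z p) \<and>
           asymptotic_constant z p \<le> ereal (\<beta>\<^sup>2 * ((1 + \<beta>) / 2))"
proof -
  obtain p where p: "p \<in> X \<inter> Y" and lim: "z \<longlonglongrightarrow> p"
    using assms(1-6) by (rule cCRM_converges)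
  have "lim z = p" using lim by (rule limI)
  then have \<omega>: "0 < \<omega>" "\<omega> < 1" and V: "p \<in> interior V"
    and eb: "\<And>x. x \<in> V \<Longrightarrow> \<omega> * infdist x (X \<inter> Y) \<le> max (infdist x X) (infdist x Y)"
    using assms(8) unfolding error_bound_def by auto
  define q where "q = \<beta>\<^sup>2 * ((1 + \<beta>) / 2)"
  have "0 < \<omega>\<^sup>2" "\<omega>\<^sup>2 < 1" using \<omega> by (simp_all add: abs_square_less_1)
  then have \<beta>: "0 < \<beta>" "\<beta> < 1" by (simp_all add: assms(9))
  have q_pos: "0 < q" using \<beta> by (simp add: q_def)
  have "q < 1 * 1"
    unfolding q_def using \<beta> by (intro mult_strict_mono) (simp_all add: abs_square_less_1)
  then have q_less: "q < 1" by simp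
  have fejer: "norm (z (Suc k) - s) \<le> norm (z k - s)" if "s \<in> X \<inter> Y" for s k
    unfolding assms(6) using assms(1-4) that by (rule cCRM_step_fejer)
  obtain r where r: "0 < r" "ball p r \<subseteq> V" using V unfolding mem_interior by blast
  have "\<forall>\<^sub>F k in sequentially. norm (z k - p) < r"
    using lim r(1) by (auto simp: tendsto_iff dist_norm)
  then have contraction:
    "\<forall>\<^sub>F k in sequentially. infdist (z (Suc k)) (X \<inter> Y) \<le> q * infdist (z k) (X \<inter> Y)"
  proof eventually_elim
    case (elim k)
    show ?case
      unfolding q_def assms(6,9)
    proof (rule cCRM_step_contraction[OF assms(1-4) p])
      fix x assume "norm (x - p) \<le> norm (z k - p)"
      then have "x \<in> V" using elim r(2) by (auto simp: dist_norm norm_minus_commute)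
      then show "\<omega> * infdist x (X \<inter> Y) \<le> max (infdist x X) (infdist x Y)" by (rule eb)
    qed (use \<omega> in auto)
  qed
  obtain C where C: "0 < C" "\<forall>\<^sub>F k in sequentially. infdist (z k) (X \<inter> Y) \<le> C * q ^ k"
    using eventual_contraction_geometric_bound[OF q_pos infdist_nonneg contraction] .
  have "\<forall>\<^sub>F k in sequentially. norm (z k - p) \<le> 2 * C * q ^ k"
    using C(2)
  proof eventually_elim
    case (elim k)
    have "norm (z k - p) \<le> 2 * infdist (z k) (X \<inter> Y)"
      using fejer_monotone_dist_limit_le[OF _ assms(5) fejer lim] assms(1,3) by (simp add: closed_Int)
    with elim show ?case by simp
  qed
  then have le: "asymptotic_constant z p \<le> ereal q"
    using C(1) q_pos by (intro asymptotic_constant_le_geometric[of "2 * C"]) auto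
  then have "asymptotic_constant z p < 1"
    using q_less by (simp add: le_less_trans[OF le])
  moreover have "0 < asymptotic_constant z p \<or> asymptotic_constant z p = 0"
    using asymptotic_constant_nonneg[of z p] unfolding order_le_less by auto
  moreover have "\<forall>k. z k \<noteq> p" using assms(7) p by metis
  ultimately have "converges_R_linearly z p \<or> converges_R_superlinearly z p"
    unfolding converges_R_linearly_def converges_R_superlinearly_def using lim by blast
  then show ?thesis using p le unfolding q_def by blast
qed

end
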